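(* Let $X$ be an implicative-orthomodular lattice. The following are equivalent: (a) $X$ is an implicative-Boolean algebra; (b) ${\le}\subseteq{\le_L}$, i.e. for all $x,y\in X$, $x\le y$ implies $x\le_L y$.
   Context: A BE algebra is an algebra $(X,\to,1)$ such that for all $x,y,z\in X$: $x\to x=1$; $x\to 1=1$; $1\to x=x$; $x\to(y\to z)=y\to(x\to z)$. It carries the relation $x\le y$ iff $x\to y=1$. It is bounded if there is $0\in X$ with $0\le x$ for all $x\in X$; then $x^*:=x\to 0$ (so $0=1^*$) and the algebra is written $(X,\to,{}^*,1)$. It is involutive if $x^{**}=x$ for all $x$, and implicative if $(x\to y)\to x=x$ for all $x,y$. An implicative-ortholattice is an implicative involutive (bounded) BE algebra. Put $x\wedge_Q y:=((x^*\to y^* )\to y^* )^*$, and $x\le_L y$ iff $x=(x\to y^* )^*$. An implicative-orthomodular lattice is an implicative-ortholattice with $x\wedge_Q(y\to x)=x$ for all $x,y$. An implicative-Boolean algebra is an implicative-ortholattice with $(y^*\to x)\to y=x\to y$ for all $x,y$. *)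

theory Defs
  imports Main
begin

text \<open>The underlying set of an algebra is the whole type \<open>'a\<close>; its operations are locale parameters.\<close>

locale be_algebra =
  fixes imp :: "'a \<Rightarrow> 'a \<Rightarrow> 'a"  (infixr "\<rightarrow>" 60)
    and one :: 'a  ("\<one>")
  assumes imp_refl: "x \<rightarrow> x = \<one>"
    and imp_one: "x \<rightarrow> \<one> = \<one>"
    and one_imp: "\<one> \<rightarrow> x = x"
    and imp_exchange: "x \<rightarrow> (y \<rightarrow> z) = y \<rightarrow> (x \<rightarrow> z)"
begin

text \<open>This relation is neither antisymmetric nor transitive in general.\<close>

definition le :: "'a \<Rightarrow> 'a \<Rightarrow> bool"  (infix "\<sqsubseteq>" 50)
  where "x \<sqsubseteq> y \<longleftrightarrow> x \<rightarrow> y = \<one>"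

end

locale bounded_be_algebra = be_algebra +
  fixes zero :: 'a  ("\<zero>")
  assumes zero_le: "\<zero> \<sqsubseteq> x"
begin

definition star :: "'a \<Rightarrow> 'a"  ("_\<^sup>\<star>" [100] 100)
  where "x\<^sup>\<star> = x \<rightarrow> \<zero>"

definition meet_Q :: "'a \<Rightarrow> 'a \<Rightarrow> 'a"  (infixl "\<sqinter>\<^sub>Q" 70)
  where "x \<sqinter>\<^sub>Q y = ((x\<^sup>\<star> \<rightarrow> y\<^sup>\<star>) \<rightarrow> y\<^sup>\<star>)\<^sup>\<star>"

definition le_L :: "'a \<Rightarrow> 'a \<Rightarrow> bool"  (infix "\<sqsubseteq>\<^sub>L" 50)
  where "x \<sqsubseteq>\<^sub>L y \<longleftrightarrow> x = (x \<rightarrow> y\<^sup>\<star>)\<^sup>\<star>"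

end

locale involutive_be_algebra = bounded_be_algebra +
  assumes star_star: "(x\<^sup>\<star>)\<^sup>\<star> = x"

locale implicative_ortholattice = involutive_be_algebra +
  assumes implicative: "(x \<rightarrow> y) \<rightarrow> x = x"

locale implicative_orthomodular_lattice = implicative_ortholattice +
  assumes orthomodular: "x \<sqinter>\<^sub>Q (y \<rightarrow> x) = x"

locale implicative_boolean_algebra = implicative_ortholattice +
  assumes boolean: "(y\<^sup>\<star> \<rightarrow> x) \<rightarrow> y = x \<rightarrow> y"

end

theory Submission
  imports Defs
begin

text \<open>
  Read \<open>x\<^sup>\<star> \<rightarrow> y\<close> as a join \<open>x \<squnion> y\<close>. The exchange law makes it commutative and associative, and the
  implicative law is an absorption law, so an implicative-ortholattice is an ortholattice with
  orthocomplement \<open>\<^sup>\<star>\<close> and lattice order \<open>\<sqsubseteq>\<^sub>L\<close>. Here \<open>x \<sqsubseteq> y\<close> only says \<open>x\<^sup>\<star> \<squnion> y = \<one>\<close>, which is weaker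
  than \<open>x \<sqsubseteq>\<^sub>L y\<close> in general, and the Boolean law reads \<open>(x \<squnion> y)\<^sup>\<star> \<squnion> y = x\<^sup>\<star> \<squnion> y\<close>.

  From Boolean to inclusion: if \<open>x\<^sup>\<star> \<squnion> y = \<one>\<close>, the Boolean law gives \<open>b\<^sup>\<star> \<squnion> y = \<one>\<close> for \<open>b = x \<squnion> y\<close>.
  Now \<open>y\<close> lies below \<open>b\<close>, and for such comparable elements orthomodularity forces \<open>b = y\<close>, that
  is, \<open>x \<sqsubseteq>\<^sub>L y\<close>.

  From inclusion to Boolean: put \<open>c = (x \<squnion> y)\<^sup>\<star> \<squnion> y\<close>. Since \<open>x \<squnion> c\<close> contains both \<open>x \<squnion> y\<close> and its
  complement, it is \<open>\<one>\<close>, so \<open>x\<^sup>\<star> \<sqsubseteq> c\<close> and hence \<open>x\<^sup>\<star> \<sqsubseteq>\<^sub>L c\<close>. Together with \<open>y \<sqsubseteq>\<^sub>L c\<close> this bounds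
  \<open>x\<^sup>\<star> \<squnion> y\<close> by \<open>c\<close>; the other bound holds in every ortholattice.

  The two directions are \<open>le_imp_le_L_if_boolean\<close> and \<open>boolean_if_le_imp_le_L\<close>.
\<close>

context involutive_be_algebra
begin

text \<open>Since \<open>y = y\<^sup>\<star> \<rightarrow> \<zero>\<close>, this is exchange in \<open>x \<rightarrow> (y\<^sup>\<star> \<rightarrow> \<zero>)\<close>.\<close>

lemma contrapositive: "y\<^sup>\<star> \<rightarrow> x\<^sup>\<star> = x \<rightarrow> y"
  by (metis imp_exchange star_def star_star)

definition join :: "'a \<Rightarrow> 'a \<Rightarrow> 'a"  (infixl "\<squnion>" 65)
  where "x \<squnion> y = x\<^sup>\<star> \<rightarrow> y"

lemma imp_eq_join: "x \<rightarrow> y = x\<^sup>\<star> \<squnion> y"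
  by (simp add: join_def star_star)

lemma join_commute: "x \<squnion> y = y \<squnion> x"
  by (metis contrapositive join_def star_star)

text \<open>Modulo commutativity this is the exchange law.\<close>

lemma join_assoc: "(x \<squnion> y) \<squnion> z = x \<squnion> (y \<squnion> z)"
  by (metis imp_exchange join_commute join_def)

lemma join_star: "x \<squnion> x\<^sup>\<star> = \<one>"
  by (simp add: join_def imp_refl)

end

context implicative_ortholattice
begin

text \<open>The implicative law as lattice absorption: \<open>(x\<^sup>\<star> \<squnion> y)\<^sup>\<star>\<close> is the meet of \<open>x\<close> and \<open>y\<^sup>\<star>\<close>.\<close>

lemma join_absorb: "x \<squnion> (x\<^sup>\<star> \<squnion> y)\<^sup>\<star> = x"
  by (metis implicative imp_eq_join join_commute)

lemma join_idem: "x \<squnion> x = x"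
  by (metis implicative join_def star_def)

lemma le_L_iff_join: "x \<sqsubseteq>\<^sub>L y \<longleftrightarrow> x \<squnion> y = y"
proof
  assume "x \<sqsubseteq>\<^sub>L y"
  then have "x = (y\<^sup>\<star> \<squnion> x\<^sup>\<star>)\<^sup>\<star>"
    by (metis le_L_def imp_eq_join join_commute)
  then show "x \<squnion> y = y"
    by (metis join_absorb join_commute)
next
  assume "x \<squnion> y = y"
  then have "x\<^sup>\<star> \<squnion> y\<^sup>\<star> = x\<^sup>\<star>"
    by (metis join_absorb star_star)
  then show "x \<sqsubseteq>\<^sub>L y"
    by (simp add: le_L_def imp_eq_join star_star)
qed

lemma boolean_if_le_imp_le_L:
  assumes le_imp_le_L: "\<And>x y. x \<sqsubseteq> y \<Longrightarrow> x \<sqsubseteq>\<^sub>L y"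
  shows "(y\<^sup>\<star> \<rightarrow> x) \<rightarrow> y = x \<rightarrow> y"
proof -
  define c where "c = (x \<squnion> y)\<^sup>\<star> \<squnion> y"
  have "x \<squnion> c = (x \<squnion> y) \<squnion> (x \<squnion> y)\<^sup>\<star>"
    by (metis c_def join_assoc join_commute)
  then have "x\<^sup>\<star> \<sqsubseteq> c"
    by (simp add: le_def join_def[symmetric] join_star)
  then have "x\<^sup>\<star> \<squnion> c = c"
    using le_imp_le_L le_L_iff_join by blast
  moreover have "y \<squnion> c = c"
    by (metis c_def join_assoc join_commute join_idem)
  ultimately have below: "(x\<^sup>\<star> \<squnion> y) \<squnion> c = c"
    by (simp add: join_assoc)
  \<comment> \<open>The meet of \<open>x\<^sup>\<star>\<close> and \<open>y\<^sup>\<star>\<close> is absorbed by \<open>x\<^sup>\<star>\<close>.\<close>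
  have "x\<^sup>\<star> \<squnion> (x \<squnion> y)\<^sup>\<star> = x\<^sup>\<star>"
    by (metis join_absorb star_star)
  then have above: "(x\<^sup>\<star> \<squnion> y) \<squnion> c = x\<^sup>\<star> \<squnion> y"
    by (metis c_def join_assoc join_commute join_idem)
  have "(y\<^sup>\<star> \<rightarrow> x) \<rightarrow> y = c"
    by (metis c_def imp_eq_join join_commute join_def)
  with below above show ?thesis
    by (simp add: imp_eq_join)
qed

end

context implicative_orthomodular_lattice
begin

text \<open>
  For elements already comparable in the lattice order, \<open>\<sqsubseteq>\<close> is antisymmetric: \<open>b \<rightarrow> y = \<one>\<close>
  turns the term \<open>y \<sqinter>\<^sub>Q b\<close> into \<open>b\<close>, whereas orthomodularity evaluates it to \<open>y\<close>.
\<close>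

lemma eq_if_le_L_if_le:
  assumes "y \<sqsubseteq>\<^sub>L b" and "b \<sqsubseteq> y"
  shows "b = y"
proof -
  have "b\<^sup>\<star> \<rightarrow> y = b"
    using assms(1) by (metis le_L_iff_join join_commute join_def)
  then have "y \<sqinter>\<^sub>Q b = y"
    by (metis orthomodular)
  moreover have "y \<sqinter>\<^sub>Q b = b"
    using assms(2) by (simp add: meet_Q_def contrapositive le_def one_imp star_star)
  ultimately show ?thesis by simp
qed

lemma le_imp_le_L_if_boolean:
  assumes boolean: "\<And>x y. (y\<^sup>\<star> \<rightarrow> x) \<rightarrow> y = x \<rightarrow> y"
    and "x \<sqsubseteq> y"
  shows "x \<sqsubseteq>\<^sub>L y"
proof -
  have "y \<squnion> x \<sqsubseteq> y"
    using assms by (simp add: le_def join_def)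
  moreover have "y \<sqsubseteq>\<^sub>L y \<squnion> x"
    by (metis le_L_iff_join join_assoc join_idem)
  ultimately have "y \<squnion> x = y"
    by (rule eq_if_le_L_if_le[rotated])
  then show ?thesis
    by (simp add: le_L_iff_join join_commute)
qed

end

theorem theorem5p8:
  fixes imp :: "'a \<Rightarrow> 'a \<Rightarrow> 'a" and one zero :: 'a
  assumes "implicative_orthomodular_lattice imp one zero"
  shows "implicative_boolean_algebra imp one zero \<longleftrightarrow>
    (\<forall>x y. be_algebra.le imp one x y \<longrightarrow> bounded_be_algebra.le_L imp zero x y)"
proof -
  interpret implicative_orthomodular_lattice imp one zero
    by (rule assms)
  show ?thesis
  proof
    assume "implicative_boolean_algebra imp one zero"
    then have "imp (imp (y\<^sup>\<star>) x) y = imp x y" for x y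
      by (rule implicative_boolean_algebra.boolean)
    then show "\<forall>x y. le x y \<longrightarrow> le_L x y"
      using le_imp_le_L_if_boolean by blast
  next
    assume "\<forall>x y. le x y \<longrightarrow> le_L x y"
    then show "implicative_boolean_algebra imp one zero"
      by unfold_locales (simp add: boolean_if_le_imp_le_L)
  qed
qed

end
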